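(* Let $\gamma\in(0,1)$ and let $\rho(w,t)$ be a solution of the modified Yard-Sale Model equation $$\frac{\partial \rho(w,t)}{\partial t}=\frac{\partial^2}{\partial w^2}\Big[D[w,\rho(\cdot,t)]\,\rho(w,t)\Big],\qquad D[w,\rho(\cdot,t)]:=\frac{\gamma}{2}\int_0^\infty \kappa(w,x)\rho(x,t)\,dx,$$ where $\kappa(w,x)=(w\wedge x)^2$ if $w\wedge x<1$ and $\kappa(w,x)=w\wedge x$ if $w\wedge x\ge 1$. Let $$G(t):=1-\int_0^\infty\int_0^\infty (w\wedge x)\,\rho(w,t)\rho(x,t)\,dx\,dw$$ be its Gini coefficient, and let $M(t):=\|\rho(\cdot,t)\|_\infty$. Then for every $t>0$ such that $M$ is finite and integrable on $[0,t]$, $$G(t)\le G(0)\exp\left(-\gamma\int_0^t M(s)\,ds\right)+\frac{\exp\left(\gamma\int_0^t M(s)\,ds\right)-1}{\exp\left(\gamma\int_0^t M(s)\,ds\right)}.$$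
   Context: Here $w\wedge x:=\min(w,x)$, $\mathbb{R}^+$ is the positive half-line, and $\|\cdot\|_\infty$ is the $L^\infty(\mathbb{R}^+)$ norm. For each $t$, $\rho(\cdot,t)$ is a probability density on $\mathbb{R}^+$ (the distribution of agents in dimensionless wealth $w$, all wealths positive) normalized to have unit zeroth and first moments: $\int_0^\infty\rho(w,t)\,dw=1$ and $\int_0^\infty w\,\rho(w,t)\,dw=1$; both moments are conserved by the dynamics. *)

theory Defs
  imports "HOL-Probability.Essential_Supremum"
begin

text \<open>
  A density is a function on \<^typ>\<open>real\<close> of which only the values on the open half-line
  \<open>{0<..}\<close> matter; \<open>\<rho> w t\<close> is the density at wealth \<open>w\<close> and time \<open>t\<close>.
\<close>

text \<open>Integrability is required separately because the Bochner integral of a non-integrable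
  function is 0 by convention.\<close>

definition normalized_density :: "(real \<Rightarrow> real) \<Rightarrow> bool" where
  "normalized_density p \<longleftrightarrow>
     (\<forall>w>0. 0 \<le> p w) \<and>
     set_integrable lborel {0<..} p \<and> (LBINT w:{0<..}. p w) = 1 \<and>
     set_integrable lborel {0<..} (\<lambda>w. w * p w) \<and> (LBINT w:{0<..}. w * p w) = 1"

definition kappa :: "real \<Rightarrow> real \<Rightarrow> real" where
  "kappa w x = (if min w x < 1 then (min w x)\<^sup>2 else min w x)"

definition diffusion :: "real \<Rightarrow> real \<Rightarrow> (real \<Rightarrow> real) \<Rightarrow> real" where
  "diffusion \<gamma> w p = \<gamma> / 2 * (LBINT x:{0<..}. kappa w x * p x)"

definition gini :: "(real \<Rightarrow> real) \<Rightarrow> real" where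
  "gini p = 1 - (LBINT w:{0<..}. (LBINT x:{0<..}. min w x * p w * p x))"

text \<open>The norm of \<open>L\<^sup>\<infinity>\<close> on the positive half-line, possibly infinite.\<close>

definition Linfty_norm :: "(real \<Rightarrow> real) \<Rightarrow> ereal" where
  "Linfty_norm p = esssup (restrict_space lborel {0<..}) (\<lambda>w. ereal \<bar>p w\<bar>)"

text \<open>
  Classical solutions for positive times: \<open>\<rho>\<^sub>t\<close> is the time derivative of \<open>\<rho>\<close>, and
  \<open>f\<^sub>w\<close>, \<open>f\<^sub>w\<^sub>w\<close> are the first and second wealth derivatives of \<open>D[w, \<rho>(\<cdot>,t)] \<rho>(w,t)\<close>;
  the two sides of the equation are jointly continuous in wealth and time.  No decay at infinity
  and no boundary behaviour at zero wealth is imposed.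

  The equation alone does not link the values at time 0 to those at positive times, so the
  initial datum is required to be attained in \<open>L\<^sup>1\<close>.  For normalized densities this holds
  as soon as \<open>\<rho>(w,t)\<close> tends to \<open>\<rho>(w,0)\<close> for almost every \<open>w\<close> (Scheffe's lemma); the
  initial density itself need not be continuous.
\<close>

definition yard_sale_solution :: "real \<Rightarrow> (real \<Rightarrow> real \<Rightarrow> real) \<Rightarrow> bool" where
  "yard_sale_solution \<gamma> \<rho> \<longleftrightarrow>
     (\<exists>\<rho>\<^sub>t f\<^sub>w f\<^sub>w\<^sub>w.
        (\<forall>w>0. \<forall>t>0.
           ((\<lambda>s. \<rho> w s) has_real_derivative \<rho>\<^sub>t w t) (at t) \<and>
           ((\<lambda>v. diffusion \<gamma> v (\<lambda>x. \<rho> x t) * \<rho> v t) has_real_derivative f\<^sub>w w t) (at w) \<and>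
           ((\<lambda>v. f\<^sub>w v t) has_real_derivative f\<^sub>w\<^sub>w w t) (at w) \<and>
           \<rho>\<^sub>t w t = f\<^sub>w\<^sub>w w t) \<and>
        continuous_on ({0<..} \<times> {0<..}) (\<lambda>(w, t). \<rho>\<^sub>t w t)) \<and>
     ((\<lambda>t. LBINT w:{0<..}. \<bar>\<rho> w t - \<rho> w 0\<bar>) \<longlongrightarrow> 0) (at_right 0)"

end

theory Submission
  imports Defs
begin

text \<open>
  Let \<open>A\<^sub>t(x) = \<integral> (w \<and> x) \<rho>(w,t) dw\<close>, so that \<open>1 - G(t) = \<integral> A\<^sub>t \<rho>(\<cdot>,t)\<close>.  Testing the equation against
  \<open>w \<mapsto> w \<and> x\<close>, whose second derivative is \<open>-\<delta>\<^sub>x\<close>, gives \<open>\<partial>\<^sub>t A\<^sub>t(x) = -D \<rho>(x,t)\<close>, and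
  \<open>\<kappa>(w,x) \<le> w \<and> x\<close> bounds the right-hand side below by \<open>-(\<gamma>/2) M(t) A\<^sub>t(x)\<close>.  Hence for every
  single \<open>x\<close> we have \<open>A\<^sub>t(x) \<ge> k A\<^sub>0(x)\<close> with \<open>k = exp(-(\<gamma>/2) \<integral>\<^sub>0\<^sup>t M)\<close>.  The bilinear form
  \<open>\<integral> A\<^sub>s \<rho>(\<cdot>,t)\<close> is symmetric in \<open>s, t\<close>, so applying this once in each argument yields
  \<open>1 - G(t) \<ge> k\<^sup>2 (1 - G(0))\<close>, which is the claim.

  Since no boundary conditions are available, \<open>w \<and> x\<close> is replaced by a tent of compact support
  in the open half-line; the flux at its two outer kinks is controlled by \<open>M\<close>.
\<close>

section \<open>Truncated means of a normalized density\<close>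

definition truncated_mean :: "(real \<Rightarrow> real) \<Rightarrow> real \<Rightarrow> real" where
  "truncated_mean p x = (LBINT w:{0<..}. min w x * p w)"

text \<open>The zeroth and first moments are both finite, so a Borel weight of at most linear growth
  is dominated by a multiple of \<open>p w + w * p w\<close>. It serves for \<open>min w x\<close>
  and for the tents.\<close>

lemma normalized_density_weight_integrable:
  assumes p: "normalized_density p" and [measurable]: "g \<in> borel_measurable borel"
    and g: "\<And>w. 0 < w \<Longrightarrow> \<bar>g w\<bar> \<le> C * (1 + w)"
  shows "set_integrable lborel {0<..} (\<lambda>w. g w * p w)"
proof (rule set_integrable_bound)
  have i: "set_integrable lborel {0<..} p" "set_integrable lborel {0<..} (\<lambda>w. w * p w)"
    and p0: "\<And>w. 0 < w \<Longrightarrow> 0 \<le> p w"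
    using p by (auto simp: normalized_density_def)
  show "set_integrable lborel {0<..} (\<lambda>w. C * (p w + w * p w))"
    using i by (intro set_integrable_mult_right set_integral_add)
  \<comment> \<open>Values of \<open>p\<close> off the half-line are arbitrary, so measurability is
    available only after multiplication by the indicator.\<close>
  have [measurable]: "(\<lambda>w. indicator {0<..} w *\<^sub>R p w) \<in> borel_measurable lborel"
    using i(1) by (auto simp: set_integrable_def)
  have "(\<lambda>w. indicator {0<..} w *\<^sub>R (g w * p w)) = (\<lambda>w. g w * (indicator {0<..} w *\<^sub>R p w))"
    by auto
  then show "set_borel_measurable lborel {0<..} (\<lambda>w. g w * p w)"
    unfolding set_borel_measurable_def by (simp only:) measurable
  show "AE w in lborel. w \<in> {0<..} \<longrightarrow> norm (g w * p w) \<le> norm (C * (p w + w * p w))"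
  proof (intro AE_I2 impI)
    fix w :: real assume "w \<in> {0<..}"
    then have w: "0 < w" by simp
    have "norm (g w * p w) = \<bar>g w\<bar> * p w" using p0[OF w] by (simp add: abs_mult)
    also have "\<dots> \<le> C * (1 + w) * p w" by (intro mult_right_mono g w p0)
    also have "\<dots> \<le> norm (C * (p w + w * p w))" by (simp add: algebra_simps)
    finally show "norm (g w * p w) \<le> norm (C * (p w + w * p w))" .
  qed
qed

lemma normalized_density_weight_mono:
  assumes p: "normalized_density p"
    and g: "set_integrable lborel {0<..} (\<lambda>w. g w * p w)"
    and h: "set_integrable lborel {0<..} (\<lambda>w. h w * p w)"
    and gh: "\<And>w. 0 < w \<Longrightarrow> g w \<le> h w"
  shows "(LBINT w:{0<..}. g w * p w) \<le> (LBINT w:{0<..}. h w * p w)"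
  using p by (intro set_integral_mono g h mult_right_mono gh) (auto simp: normalized_density_def)

lemma min_integrable:
  assumes "normalized_density p" "0 < x"
  shows "set_integrable lborel {0<..} (\<lambda>w. min w x * p w)"
  by (rule normalized_density_weight_integrable[OF assms(1), where C = 1])
     (use assms(2) in auto)

lemma
  assumes p: "normalized_density p" and x: "0 < x"
  shows truncated_mean_nonneg: "0 \<le> truncated_mean p x"
    and truncated_mean_le_1: "truncated_mean p x \<le> 1"
    and truncated_mean_le: "truncated_mean p x \<le> x"
proof -
  have i: "set_integrable lborel {0<..} p" "set_integrable lborel {0<..} (\<lambda>w. w * p w)"
    and p1: "(LBINT w:{0<..}. p w) = 1" "(LBINT w:{0<..}. w * p w) = 1"
    and p0: "\<And>w. 0 < w \<Longrightarrow> 0 \<le> p w"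
    using p by (auto simp: normalized_density_def)
  show "0 \<le> truncated_mean p x"
    unfolding truncated_mean_def set_lebesgue_integral_def
    by (rule Bochner_Integration.integral_nonneg) (use p0 x in \<open>auto simp: indicator_def\<close>)
  show "truncated_mean p x \<le> 1"
    unfolding truncated_mean_def p1(2)[symmetric]
    by (rule normalized_density_weight_mono[OF p min_integrable[OF p x] i(2)]) simp
  have "truncated_mean p x \<le> (LBINT w:{0<..}. x * p w)"
    unfolding truncated_mean_def
    by (rule normalized_density_weight_mono[OF p min_integrable[OF p x]]) (use i in auto)
  then show "truncated_mean p x \<le> x" using p1 by simp
qed

text \<open>Pointwise \<open>min w x \<le> min w y + \<bar>x - y\<bar>\<close>, and \<open>p\<close>
  has mass 1. Exchanging \<open>x\<close> and \<open>y\<close> gives the other side.\<close>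

lemma truncated_mean_Lipschitz:
  assumes p: "normalized_density p" and x: "0 < x" "0 < y"
  shows "truncated_mean p x \<le> truncated_mean p y + \<bar>x - y\<bar>"
proof -
  have i: "set_integrable lborel {0<..} p" and p1: "(LBINT w:{0<..}. p w) = 1"
    using p by (auto simp: normalized_density_def)
  have j: "set_integrable lborel {0<..} (\<lambda>w. min w y * p w + \<bar>x - y\<bar> * p w)"
    by (intro set_integral_add min_integrable p x set_integrable_mult_right i)
  have "truncated_mean p x \<le> (LBINT w:{0<..}. (min w y + \<bar>x - y\<bar>) * p w)"
    unfolding truncated_mean_def
    by (rule normalized_density_weight_mono[OF p min_integrable[OF p x(1)]])
       (use j in \<open>auto simp: algebra_simps\<close>)
  also have "\<dots> = (LBINT w:{0<..}. min w y * p w + \<bar>x - y\<bar> * p w)"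
    by (simp add: algebra_simps)
  also have "\<dots> = truncated_mean p y + \<bar>x - y\<bar>"
    unfolding truncated_mean_def
    by (subst set_integral_add(2)) (use i p1 min_integrable[OF p x(2)] in auto)
  finally show ?thesis .
qed

lemma continuous_on_truncated_mean:
  assumes "normalized_density p"
  shows "continuous_on {0<..} (truncated_mean p)"
proof (rule continuous_onI)
  fix x e :: real assume x: "x \<in> {0<..}" and e: "0 < e"
  have "dist (truncated_mean p y) (truncated_mean p x) \<le> e" if "y \<in> {0<..}" "dist y x < e" for y
    using truncated_mean_Lipschitz[OF assms, of x y] truncated_mean_Lipschitz[OF assms, of y x]
      that x by (auto simp: dist_real_def abs_le_iff abs_minus_commute)
  then show "\<exists>d>0. \<forall>y\<in>{0<..}. dist y x < d \<longrightarrow>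
      dist (truncated_mean p y) (truncated_mean p x) \<le> e"
    using e by blast
qed

section \<open>Kernel, diffusion coefficient and flux against the sup norm\<close>

lemma kappa_nonneg: "0 < w \<Longrightarrow> 0 < x \<Longrightarrow> 0 \<le> kappa w x"
  by (simp add: kappa_def)

lemma kappa_le_min: "0 < w \<Longrightarrow> 0 < x \<Longrightarrow> kappa w x \<le> min w x"
  using mult_left_le[of "min w x" "min w x"] by (auto simp: kappa_def power2_eq_square)

lemma
  assumes p: "normalized_density p" and w: "0 < w" and "0 < \<gamma>"
  shows diffusion_nonneg: "0 \<le> diffusion \<gamma> w p"
    and diffusion_le: "diffusion \<gamma> w p \<le> \<gamma> / 2 * truncated_mean p w"
proof -
  have p0: "\<And>w. 0 < w \<Longrightarrow> 0 \<le> p w"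
    using p by (auto simp: normalized_density_def)
  have "0 \<le> (LBINT x:{0<..}. kappa w x * p x)"
    unfolding set_lebesgue_integral_def
    by (rule Bochner_Integration.integral_nonneg)
       (use p0 w kappa_nonneg in \<open>auto simp: indicator_def\<close>)
  then show "0 \<le> diffusion \<gamma> w p"
    using \<open>0 < \<gamma>\<close> by (simp add: diffusion_def)
  have "(LBINT x:{0<..}. kappa w x * p x) \<le> truncated_mean p w"
    unfolding set_lebesgue_integral_def truncated_mean_def
  \<comment> \<open>Only the majorant must be integrable: a non-integrable left side would have
    integral 0 by convention, and the majorant is nonnegative.\<close>
  proof (rule integral_mono')
    show "integrable lborel (\<lambda>x. indicator {0<..} x *\<^sub>R (min x w * p x))"
      using min_integrable[OF p w] by (simp add: set_integrable_def)
    fix x :: real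
    show "indicator {0<..} x *\<^sub>R (kappa w x * p x) \<le> indicator {0<..} x *\<^sub>R (min x w * p x)"
      using kappa_le_min[OF w, of x] p0[of x]
      by (auto simp: indicator_def min.commute intro: mult_right_mono)
    show "0 \<le> indicator {0<..} x *\<^sub>R (min x w * p x)"
      using w p0[of x] by (auto simp: indicator_def)
  qed
  then show "diffusion \<gamma> w p \<le> \<gamma> / 2 * truncated_mean p w"
    using \<open>0 < \<gamma>\<close> by (simp add: diffusion_def)
qed

text \<open>Finiteness is essential to the real-valued form, since \<open>real_of_ereal\<close>
  sends infinity to 0.\<close>

lemma AE_Linfty_norm:
  assumes "Linfty_norm p < \<infinity>"
  shows "AE w in lborel. 0 < w \<longrightarrow> \<bar>p w\<bar> \<le> real_of_ereal (Linfty_norm p)"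
proof -
  have "AE w in restrict_space lborel {0<..}. ereal \<bar>p w\<bar> \<le> Linfty_norm p"
    unfolding Linfty_norm_def by (rule esssup_AE)
  then have "AE w in lborel. w \<in> {0<..} \<longrightarrow> ereal \<bar>p w\<bar> \<le> Linfty_norm p"
    by (subst (asm) AE_restrict_space_iff) auto
  then show ?thesis
  proof eventually_elim
    case (elim w)
    then show ?case using assms by (cases "Linfty_norm p") auto
  qed
qed

text \<open>The essential supremum only controls the density almost everywhere, whereas the flux
  has to be evaluated at single points; its continuity bridges the gap.\<close>

lemma flux_le:
  assumes p: "normalized_density p" and "0 < \<gamma>" and fin: "Linfty_norm p < \<infinity>"
    and cont: "continuous_on {0<..} (\<lambda>v. diffusion \<gamma> v p * p v)" and w: "0 < w"
  shows "diffusion \<gamma> w p * p w \<le> \<gamma> / 2 * real_of_ereal (Linfty_norm p) * truncated_mean p w"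
proof -
  let ?m = "real_of_ereal (Linfty_norm p)"
  \<comment> \<open>On a compact interval inside the half-line the inequality cuts out a set closed
    in the reals; a closed set containing almost every point of an open interval contains all of it,
    in particular \<open>w\<close>.\<close>
  define C where "C = {v \<in> {w/2..2*w}. diffusion \<gamma> v p * p v \<le> \<gamma> / 2 * ?m * truncated_mean p v}"
  have sub: "{w/2..2*w} \<subseteq> {0<..}" using w by auto
  have "closed C"
    unfolding C_def
    by (intro continuous_on_closed_Collect_le continuous_on_subset[OF cont sub] continuous_intros
        continuous_on_subset[OF continuous_on_truncated_mean[OF p] sub])
       (simp_all)
  moreover have "AE v in lborel. v \<in> {w/2<..<2*w} \<longrightarrow> v \<in> C"
    using AE_Linfty_norm[OF fin]
  proof eventually_elim
    case (elim v)
    show ?case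
    proof
      assume v: "v \<in> {w/2<..<2*w}"
      then have v0: "0 < v" using w by auto
      have "0 \<le> p v" using p v0 by (auto simp: normalized_density_def)
      then have pv: "p v \<le> ?m" using elim v0 by simp
      have "diffusion \<gamma> v p * p v \<le> (\<gamma> / 2 * truncated_mean p v) * ?m"
        by (intro mult_mono diffusion_le p v0 \<open>0 < \<gamma>\<close> pv \<open>0 \<le> p v\<close>)
           (use truncated_mean_nonneg[OF p v0] \<open>0 < \<gamma>\<close> in auto)
      then show "v \<in> C" using v by (simp add: C_def algebra_simps)
    qed
  qed
  then have "AE v \<in> {w/2<..<2*w} in lebesgue. v \<in> C"
    by (rule AE_completion)
  ultimately have "w \<in> C"
    using w by (intro mem_closed_if_AE_lebesgue_open[of "{w/2<..<2*w}" C w]) simp_all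
  then show ?thesis by (simp add: C_def)
qed

text \<open>If the norm is finite, it bounds some \<open>\<bar>p w\<bar>\<close> because the
  half-line is not a null set; if it is infinite, \<open>real_of_ereal\<close> returns 0.\<close>

lemma real_Linfty_norm_nonneg: "0 \<le> real_of_ereal (Linfty_norm p)"
proof (cases "Linfty_norm p < \<infinity>")
  case True
  have "\<exists>w>0. \<bar>p w\<bar> \<le> real_of_ereal (Linfty_norm p)"
  proof (rule ccontr)
    assume "\<not> ?thesis"
    then have "AE w in lborel. \<not> 0 < (w::real)"
      using AE_Linfty_norm[OF True] by (auto elim: eventually_mono)
    then have "AE w \<in> {0<..<1} in lebesgue. w \<in> {..0::real}"
      by (intro AE_completion) (auto elim: eventually_mono)
    then have "(1/2::real) \<in> {..0}"
      by (intro mem_closed_if_AE_lebesgue_open[of "{0<..<1}" "{..0}"]) simp_all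
    then show False by simp
  qed
  then show ?thesis by (meson abs_ge_zero order_trans)
qed simp

section \<open>From short-time linear decay to exponential decay\<close>

text \<open>Subdividing into \<open>n\<close> pieces on which \<open>m\<close> grows equally turns the one-step estimate into
  \<open>(1 - (m t - m s) / n) ^ n\<close>.\<close>

lemma exp_decay_of_short_decay:
  fixes a m :: "real \<Rightarrow> real"
  assumes "s \<le> t" and cont: "continuous_on {s..t} m" and mono: "mono_on {s..t} m"
    and a0: "0 \<le> a s"
    and step: "\<And>p q. s \<le> p \<Longrightarrow> p \<le> q \<Longrightarrow> q \<le> t \<Longrightarrow> a p * (1 - (m q - m p)) \<le> a q"
  shows "a s * exp (- (m t - m s)) \<le> a t"
proof -
  let ?d = "m t - m s"
  have d0: "0 \<le> ?d" using mono_onD[OF mono, of s t] \<open>s \<le> t\<close> by simp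
  \<comment> \<open>The condition \<open>?d \<le> real n\<close> keeps the factor
    \<open>1 - ?d / n\<close> nonnegative, so that it can multiply the inequality of the induction
    hypothesis.\<close>
  have bound: "a s * (1 + - ?d / real n) ^ n \<le> a t" if n: "0 < n" "?d \<le> real n" for n
  proof -
    have q: "0 \<le> 1 - ?d / real n" using n by simp
    have "\<exists>p\<in>{s..t}. m p = m s + real k * (?d / real n) \<and> a s * (1 - ?d / real n) ^ k \<le> a p"
      if "k \<le> n" for k
      using that
    proof (induction k)
      case 0
      then show ?case using \<open>s \<le> t\<close> by (intro bexI[of _ s]) auto
    next
      case (Suc k)
      then obtain p where p: "s \<le> p" "p \<le> t" "m p = m s + real k * (?d / real n)"
        and ap: "a s * (1 - ?d / real n) ^ k \<le> a p" by auto
      let ?y = "m s + real (Suc k) * (?d / real n)"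
      have "real (Suc k) * (?d / real n) \<le> real n * (?d / real n)"
        using Suc.prems d0 by (intro mult_right_mono) auto
      then have "?y \<le> m t" using n by simp
      moreover have my: "?y = m p + ?d / real n"
        by (simp only: p of_nat_Suc) (simp add: distrib_right add_divide_distrib)
      then have "m p \<le> ?y" using d0 n by simp
      ultimately obtain q where q': "p \<le> q" "q \<le> t" "m q = ?y"
        \<comment> \<open>The subdivision is equal in the values of \<open>m\<close>, not in time;
          continuity supplies the next time at which \<open>m\<close> has gained one more
          share.\<close>
        using IVT'[of m p ?y t] p continuous_on_subset[OF cont, of "{p..t}"] by auto
      have "a s * (1 - ?d / real n) ^ Suc k = (a s * (1 - ?d / real n) ^ k) * (1 - ?d / real n)"
        by simp
      also have "\<dots> \<le> a p * (1 - (m q - m p))"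
        unfolding q' my using ap q by (simp add: mult_right_mono)
      also have "\<dots> \<le> a q" using step[of p q] p q' by simp
      finally show ?case using p q' by (intro bexI[of _ q]) auto
    qed
    from this[of n] obtain p where p: "s \<le> p" "p \<le> t" "m p = m t"
      and "a s * (1 - ?d / real n) ^ n \<le> a p" using n by auto
    \<comment> \<open>The last point \<open>p\<close> may lie before \<open>t\<close>, but
      \<open>m\<close> is equal at both, so the step from \<open>p\<close> to \<open>t\<close> has
      factor 1.\<close>
    then show ?thesis using step[of p t] \<open>s \<le> p\<close> \<open>p \<le> t\<close> \<open>m p = m t\<close>
      by (simp only: add_uminus_conv_diff minus_divide_left[symmetric]) simp
  qed
  have "(\<lambda>n. a s * (1 + - ?d / real n) ^ n) \<longlonglongrightarrow> a s * exp (- ?d)"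
    by (intro tendsto_intros tendsto_exp_limit_sequentially)
  moreover have "\<forall>\<^sub>F n in sequentially. a s * (1 + - ?d / real n) ^ n \<le> a t"
    using eventually_gt_at_top[of "0::nat"] eventually_ge_at_top[of "nat \<lceil>?d\<rceil>"]
    by eventually_elim (rule bound, simp, linarith)
  ultimately show ?thesis
    by (rule tendsto_upperbound) simp
qed

section \<open>Tent-shaped test functions\<close>

text \<open>A tent with slope \<open>1\<close> on \<open>[e, x]\<close> and slope \<open>-e\<close> from its peak at \<open>x\<close> down to \<open>tent_end e x\<close>;
  it tends to \<open>min w x\<close> as \<open>e\<close> tends to 0.\<close>

definition tent :: "real \<Rightarrow> real \<Rightarrow> real \<Rightarrow> real" where
  "tent e x w = max 0 (min (w - e) (x - e - e * (w - x)))"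

definition tent_end :: "real \<Rightarrow> real \<Rightarrow> real" where
  "tent_end e x = x + (x - e) / e"

lemma tent_measurable [measurable]: "tent e x \<in> borel_measurable borel"
  unfolding tent_def by measurable

text \<open>The small slope on the right keeps the loss below \<open>e * (1 + w)\<close>, which both
  moments can integrate.\<close>

lemma tent_bounds:
  assumes "0 < e" "e < x" "0 < w"
  shows "0 \<le> tent e x w" "tent e x w \<le> min w x" "min w x - e * (1 + w) \<le> tent e x w"
proof -
  show "0 \<le> tent e x w" by (simp add: tent_def)
  have "w \<le> x \<or> 0 \<le> e * (w - x)" "0 \<le> e * w" using assms by (auto simp: zero_le_mult_iff)
  then show "tent e x w \<le> min w x" using assms by (auto simp: tent_def)
  have "0 \<le> e * x" using assms by simp
  then show "min w x - e * (1 + w) \<le> tent e x w"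
    using \<open>0 \<le> e * w\<close> by (auto simp: tent_def algebra_simps max_def min_def)
qed

lemma tent_eq_0:
  assumes "0 < e" "e < x" "w \<notin> {e..tent_end e x}"
  shows "tent e x w = 0"
proof (cases "w < e")
  case False
  then have "e * (w - x) > x - e" using assms by (simp add: tent_end_def field_simps)
  then show ?thesis by (simp add: tent_def)
qed (simp add: tent_def)

text \<open>Two integrations by parts: the slope jumps by \<open>1\<close> at \<open>e\<close>, by
  \<open>-(1 + e)\<close> at \<open>x\<close> and by \<open>e\<close> at the outer end, so the
  second derivative of the tent is a combination of three point masses.\<close>

lemma tent_has_integral:
  assumes e: "0 < e" "e < x"
    and g: "\<And>w. 0 < w \<Longrightarrow> (g has_real_derivative g' w) (at w)"
    and g': "\<And>w. 0 < w \<Longrightarrow> (g' has_real_derivative g'' w) (at w)"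
  shows "((\<lambda>w. tent e x w * g'' w) has_integral
    (g e - (1 + e) * g x + e * g (tent_end e x))) {e..tent_end e x}"
proof -
  let ?R = "tent_end e x"
  have R: "x \<le> ?R" "e * (?R - x) = x - e" using e by (auto simp: tent_end_def)
  have rise: "tent e x w = w - e" if "w \<in> {e..x}" for w
  proof -
    have "e * (w - x) \<le> 0" using that e by (simp add: mult_nonneg_nonpos)
    then show ?thesis using that by (simp add: tent_def)
  qed
  have fall: "tent e x w = e * (?R - w)" if "w \<in> {x..?R}" for w
  proof -
    have "e * (?R - w) = x - e - e * (w - x)" using R(2) by (simp add: algebra_simps)
    moreover have "0 \<le> e * (?R - w)" "0 \<le> e * (w - x)" using that e by auto
    moreover have "x - e - e * (w - x) \<le> w - e" using that \<open>0 \<le> e * (w - x)\<close> by simp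
    ultimately show ?thesis by (simp only: tent_def min_absorb2 max_absorb2)
  qed
  \<comment> \<open>For affine \<open>h\<close>, \<open>h * g' - h' * g\<close> is an antiderivative
    of \<open>h * g''\<close>; here \<open>h\<close> is either side of the tent.\<close>
  have d1: "((\<lambda>w. (w - e) * g' w - g w) has_real_derivative (w - e) * g'' w) (at w)"
    and d2: "((\<lambda>w. e * (?R - w) * g' w + e * g w) has_real_derivative e * (?R - w) * g'' w) (at w)"
    if "0 < w" for w
    by (rule derivative_eq_intros g[OF that] g'[OF that] refl | simp add: algebra_simps)+
  have "((\<lambda>w. (w - e) * g'' w) has_integral
      ((x - e) * g' x - g x) - ((e - e) * g' e - g e)) {e..x}"
    using e
    by (intro fundamental_theorem_of_calculus[where f = "\<lambda>w. (w - e) * g' w - g w"])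
       (auto intro!: has_field_derivative_at_within[OF d1]
         simp flip: has_real_derivative_iff_has_vector_derivative)
  moreover have "((\<lambda>w. (w - e) * g'' w) has_integral i) {e..x} \<longleftrightarrow>
      ((\<lambda>w. tent e x w * g'' w) has_integral i) {e..x}" for i
    by (intro has_integral_cong) (simp add: rise)
  ultimately have 1: "((\<lambda>w. tent e x w * g'' w) has_integral (x - e) * g' x - g x + g e) {e..x}"
    by simp
  have "((\<lambda>w. e * (?R - w) * g'' w) has_integral
      (e * (?R - ?R) * g' ?R + e * g ?R) - (e * (?R - x) * g' x + e * g x)) {x..?R}"
    using e R(1)
    by (intro fundamental_theorem_of_calculus[where f = "\<lambda>w. e * (?R - w) * g' w + e * g w"])
       (auto intro!: has_field_derivative_at_within[OF d2]
         simp flip: has_real_derivative_iff_has_vector_derivative)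
  moreover have "((\<lambda>w. e * (?R - w) * g'' w) has_integral i) {x..?R} \<longleftrightarrow>
      ((\<lambda>w. tent e x w * g'' w) has_integral i) {x..?R}" for i
    by (intro has_integral_cong) (simp add: fall)
  ultimately have 2: "((\<lambda>w. tent e x w * g'' w) has_integral
      e * g ?R - ((x - e) * g' x + e * g x)) {x..?R}"
    unfolding R(2) by simp
  \<comment> \<open>Both sides have height \<open>x - e\<close> at the peak, so the terms with
    \<open>g' x\<close> cancel.\<close>
  show ?thesis
    using has_integral_combine[OF _ R(1) 1 2] e by (simp add: algebra_simps)
qed

lemma tent_integrable:
  assumes "normalized_density p" "0 < e" "e < x"
  shows "set_integrable lborel {0<..} (\<lambda>w. tent e x w * p w)"
proof (rule normalized_density_weight_integrable[OF assms(1), where C = 1])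
  fix w :: real assume "0 < w"
  then show "\<bar>tent e x w\<bar> \<le> 1 * (1 + w)"
    using tent_bounds[OF assms(2,3), of w] by simp
qed simp

text \<open>The constant 2 is the sum of the zeroth and first moments, against which the error
  \<open>e * (1 + w)\<close> is integrated.\<close>

lemma
  assumes p: "normalized_density p" and e: "0 < e" "e < x"
  shows tent_le_truncated_mean: "(LBINT w:{0<..}. tent e x w * p w) \<le> truncated_mean p x"
    and truncated_mean_le_tent: "truncated_mean p x \<le> (LBINT w:{0<..}. tent e x w * p w) + 2 * e"
proof -
  have x: "0 < x" using e by simp
  have i: "set_integrable lborel {0<..} p" "set_integrable lborel {0<..} (\<lambda>w. w * p w)"
    and p1: "(LBINT w:{0<..}. p w) = 1" "(LBINT w:{0<..}. w * p w) = 1"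
    using p by (auto simp: normalized_density_def)
  note t = tent_integrable[OF p e]
  show "(LBINT w:{0<..}. tent e x w * p w) \<le> truncated_mean p x"
    unfolding truncated_mean_def
    by (intro normalized_density_weight_mono[OF p t min_integrable[OF p x]] tent_bounds e)
  have eq: "(tent e x w + e * (1 + w)) * p w = tent e x w * p w + (e * p w + e * (w * p w))" for w
    by (simp add: algebra_simps)
  have j: "set_integrable lborel {0<..} (\<lambda>w. e * p w + e * (w * p w))"
    by (intro set_integral_add set_integrable_mult_right i)
  have "truncated_mean p x \<le> (LBINT w:{0<..}. (tent e x w + e * (1 + w)) * p w)"
    unfolding truncated_mean_def
  proof (rule normalized_density_weight_mono[OF p min_integrable[OF p x]])
    show "set_integrable lborel {0<..} (\<lambda>w. (tent e x w + e * (1 + w)) * p w)"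
      unfolding eq by (intro set_integral_add t j)
    show "min w x \<le> tent e x w + e * (1 + w)" if "0 < w" for w
      using tent_bounds(3)[OF e that] by simp
  qed
  also have "\<dots> = (LBINT w:{0<..}. tent e x w * p w) +
      ((LBINT w:{0<..}. e * p w) + (LBINT w:{0<..}. e * (w * p w)))"
    unfolding eq
    by (subst set_integral_add(2)[OF t j], subst set_integral_add(2))
       (use i in auto)
  finally show "truncated_mean p x \<le> (LBINT w:{0<..}. tent e x w * p w) + 2 * e"
    using p1 by simp
qed

text \<open>Compact support turns Lebesgue integrals over the half-line into a gauge integral over
  an interval, where the fundamental theorem and the exchange of integrals apply.\<close>

lemma tent_set_integral:
  assumes "normalized_density p" "normalized_density q" "0 < e" "e < x"
  shows "(LBINT w:{0<..}. tent e x w * p w) - (LBINT w:{0<..}. tent e x w * q w) =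
    integral {e..tent_end e x} (\<lambda>w. tent e x w * (p w - q w))"
proof -
  let ?f = "\<lambda>w. tent e x w * (p w - q w)"
  note i = tent_integrable[OF assms(1,3,4)] tent_integrable[OF assms(2,3,4)]
  have f: "set_integrable lborel {0<..} ?f"
    using set_integral_diff(1)[OF i] by (simp add: algebra_simps)
  have sub: "{e..tent_end e x} \<subseteq> {0<..}" using assms by auto
  have "(LBINT w:{0<..}. tent e x w * p w) - (LBINT w:{0<..}. tent e x w * q w) =
      (LBINT w:{0<..}. ?f w)"
    using set_integral_diff(2)[OF i] by (simp add: algebra_simps)
  also have "\<dots> = (LBINT w:{e..tent_end e x}. ?f w)"
    unfolding set_lebesgue_integral_def
    using tent_eq_0[OF assms(3,4)] assms(3)
    by (intro Bochner_Integration.integral_cong) (auto simp: indicator_def)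
  also have "\<dots> = integral {e..tent_end e x} ?f"
    by (intro set_borel_integral_eq_integral(2) set_integrable_subset[OF f _ sub]) simp
  finally show ?thesis .
qed

text \<open>Apply the fundamental theorem in time at each fixed \<open>w\<close>, then exchange the
  integrals of a jointly continuous function on a rectangle.\<close>

lemma integral_time_increment:
  fixes u u\<^sub>t :: "real \<Rightarrow> real \<Rightarrow> real"
  assumes "s \<le> t" and \<phi>: "continuous_on {a..b} \<phi>"
    and cont: "continuous_on ({a..b} \<times> {s..t}) (\<lambda>(w, r). u\<^sub>t w r)"
    and deriv: "\<And>w r. w \<in> {a..b} \<Longrightarrow> r \<in> {s..t} \<Longrightarrow> ((\<lambda>r. u w r) has_real_derivative u\<^sub>t w r) (at r)"
  shows "integral {a..b} (\<lambda>w. \<phi> w * (u w t - u w s)) =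
      integral {s..t} (\<lambda>r. integral {a..b} (\<lambda>w. \<phi> w * u\<^sub>t w r))" (is ?eq)
    and "(\<lambda>r. integral {a..b} (\<lambda>w. \<phi> w * u\<^sub>t w r)) integrable_on {s..t}" (is ?int)
proof -
  have prod: "continuous_on ({a..b} \<times> {s..t}) (\<lambda>(w, r). \<phi> w * u\<^sub>t w r)"
    using cont unfolding case_prod_unfold
    by (intro continuous_intros continuous_on_compose2[OF \<phi>]) auto
  have "continuous_on ({s..t} \<times> {a..b}) (\<lambda>x. (\<lambda>(w, r). \<phi> w * u\<^sub>t w r) (prod.swap x))"
    by (intro continuous_on_compose2[OF prod] continuous_on_swap) auto
  then have "continuous_on ({s..t} \<times> cbox a b) (\<lambda>(r, w). \<phi> w * u\<^sub>t w r)"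
    by (simp add: case_prod_unfold)
  then show ?int
    by (intro integrable_continuous_real) (use integral_continuous_on_param in fastforce)
  have "integral {a..b} (\<lambda>w. \<phi> w * (u w t - u w s)) =
      integral {a..b} (\<lambda>w. integral {s..t} (\<lambda>r. \<phi> w * u\<^sub>t w r))"
  proof (rule integral_cong)
    fix w assume w: "w \<in> {a..b}"
    have "(u\<^sub>t w has_integral (u w t - u w s)) {s..t}"
      using deriv[OF w] \<open>s \<le> t\<close>
      by (intro fundamental_theorem_of_calculus)
         (auto simp flip: has_real_derivative_iff_has_vector_derivative
           intro: has_field_derivative_at_within)
    then show "\<phi> w * (u w t - u w s) = integral {s..t} (\<lambda>r. \<phi> w * u\<^sub>t w r)"
      by (metis has_integral_mult_right integral_unique)
  qed
  also have "\<dots> = integral {s..t} (\<lambda>r. integral {a..b} (\<lambda>w. \<phi> w * u\<^sub>t w r))"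
    using integral_swap_continuous[of a s b t "\<lambda>w r. \<phi> w * u\<^sub>t w r"] prod
    by (simp add: cbox_Pair_eq)
  finally show ?eq .
qed
text \<open>Removes the tent parameter: the error constant \<open>c\<close> must not depend on
  \<open>e\<close>.\<close>

lemma le_of_le_add_small:
  fixes a b c d :: real
  assumes "0 < d" "\<And>e. 0 < e \<Longrightarrow> e < d \<Longrightarrow> a \<le> b + e * c"
  shows "a \<le> b"
proof (rule tendsto_lowerbound)
  show "((\<lambda>e. b + e * c) \<longlongrightarrow> b) (at_right 0)" by (auto intro!: tendsto_eq_intros)
  show "\<forall>\<^sub>F e in at_right 0. a \<le> b + e * c"
    using eventually_at_right_real[OF assms(1)] by eventually_elim (use assms(2) in auto)
qed simp

section \<open>Evolution of truncated means along a solution\<close>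

locale yard_sale_flow =
  fixes \<gamma> T :: real and \<rho> \<rho>\<^sub>t f\<^sub>w f\<^sub>w\<^sub>w :: "real \<Rightarrow> real \<Rightarrow> real"
  assumes \<gamma>_pos: "0 < \<gamma>"
    and density: "\<And>s. 0 \<le> s \<Longrightarrow> normalized_density (\<lambda>w. \<rho> w s)"
    and \<rho>_deriv: "\<And>w t. 0 < w \<Longrightarrow> 0 < t \<Longrightarrow> ((\<lambda>s. \<rho> w s) has_real_derivative \<rho>\<^sub>t w t) (at t)"
    and flux_deriv: "\<And>w t. 0 < w \<Longrightarrow> 0 < t \<Longrightarrow>
      ((\<lambda>v. diffusion \<gamma> v (\<lambda>x. \<rho> x t) * \<rho> v t) has_real_derivative f\<^sub>w w t) (at w)"
    and flux_deriv2: "\<And>w t. 0 < w \<Longrightarrow> 0 < t \<Longrightarrow>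
      ((\<lambda>v. f\<^sub>w v t) has_real_derivative f\<^sub>w\<^sub>w w t) (at w)"
    and pde: "\<And>w t. 0 < w \<Longrightarrow> 0 < t \<Longrightarrow> \<rho>\<^sub>t w t = f\<^sub>w\<^sub>w w t"
    and cont: "continuous_on ({0<..} \<times> {0<..}) (\<lambda>(w, t). \<rho>\<^sub>t w t)"
    and initial: "((\<lambda>t. LBINT w:{0<..}. \<bar>\<rho> w t - \<rho> w 0\<bar>) \<longlongrightarrow> 0) (at_right 0)"
    and fin: "\<And>s. s \<in> {0..T} \<Longrightarrow> Linfty_norm (\<lambda>w. \<rho> w s) < \<infinity>"
    and norm_integrable: "set_integrable lborel {0..T} (\<lambda>s. real_of_ereal (Linfty_norm (\<lambda>w. \<rho> w s)))"
begin

definition flux :: "real \<Rightarrow> real \<Rightarrow> real" where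
  "flux w s = diffusion \<gamma> w (\<lambda>x. \<rho> x s) * \<rho> w s"

definition A :: "real \<Rightarrow> real \<Rightarrow> real" where
  "A x s = truncated_mean (\<lambda>w. \<rho> w s) x"

definition M :: "real \<Rightarrow> real" where
  "M s = real_of_ereal (Linfty_norm (\<lambda>w. \<rho> w s))"

text \<open>The rate of change of the tent integral of the density; see
  \<open>tent_evolution\<close>.\<close>

definition K :: "real \<Rightarrow> real \<Rightarrow> real \<Rightarrow> real" where
  "K e x s = integral {e..tent_end e x} (\<lambda>w. tent e x w * \<rho>\<^sub>t w s)"

lemma A_bounds:
  assumes "0 < x" "0 \<le> s"
  shows "0 \<le> A x s" "A x s \<le> 1" "A x s \<le> x"
  unfolding A_def
  by (simp_all add: assms density truncated_mean_nonneg truncated_mean_le_1 truncated_mean_le)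

lemma M_nonneg: "0 \<le> M s"
  by (simp add: M_def real_Linfty_norm_nonneg)

lemma M_integrable_on: "{p..q} \<subseteq> {0..T} \<Longrightarrow> M integrable_on {p..q}"
  using set_borel_integral_eq_integral(1)[OF norm_integrable]
  unfolding M_def by (rule integrable_on_subinterval)

lemma flux_bounds:
  assumes "0 < w" "0 < s" "s \<le> T"
  shows "0 \<le> flux w s" "flux w s \<le> \<gamma> / 2 * M s * A w s"
proof -
  show "0 \<le> flux w s"
    using density[of s] assms diffusion_nonneg[OF density \<open>0 < w\<close> \<gamma>_pos, of s]
    by (simp add: flux_def normalized_density_def)
  have "continuous_on {0<..} (\<lambda>v. diffusion \<gamma> v (\<lambda>x. \<rho> x s) * \<rho> v s)"
    using flux_deriv[OF _ \<open>0 < s\<close>] by (auto intro!: continuous_at_imp_continuous_on DERIV_isCont)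
  then show "flux w s \<le> \<gamma> / 2 * M s * A w s"
    unfolding flux_def M_def A_def using assms
    by (intro flux_le density \<gamma>_pos fin) auto
qed

text \<open>By the equation, \<open>K\<close> combines the fluxes at the three kinks of the tent.
  The upper bound discards the peak, the lower bound the two outer kinks, all fluxes being
  nonnegative.\<close>

lemma K_bounds:
  assumes e: "0 < e" "e < x" and s: "0 < s" "s \<le> T"
  shows "K e x s \<le> \<gamma> * e * M s" "- ((1 + e) * (\<gamma> / 2) * M s * A x s) \<le> K e x s"
proof -
  let ?R = "tent_end e x"
  have R: "0 < ?R" using e by (simp add: tent_end_def add_pos_pos)
  have "((\<lambda>w. tent e x w * f\<^sub>w\<^sub>w w s) has_integral
      (flux e s - (1 + e) * flux x s + e * flux ?R s)) {e..?R}"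
    unfolding flux_def using flux_deriv flux_deriv2 s e by (intro tent_has_integral) auto
  moreover have "K e x s = integral {e..?R} (\<lambda>w. tent e x w * f\<^sub>w\<^sub>w w s)"
    unfolding K_def using pde s e by (intro integral_cong) auto
  ultimately have K: "K e x s = flux e s - (1 + e) * flux x s + e * flux ?R s"
    by (simp add: integral_unique)
  have M: "0 \<le> \<gamma> / 2 * M s" using \<gamma>_pos M_nonneg by simp
  have x: "0 < x" using e by simp
  \<comment> \<open>At the inner kink smallness comes from \<open>A e s \<le> e\<close>.\<close>
  have "flux e s \<le> \<gamma> / 2 * M s * e"
    using flux_bounds(2)[OF e(1) s] mult_left_mono[OF A_bounds(3)[OF e(1), of s] M] s by linarith
  \<comment> \<open>At the outer kink only \<open>A \<le> 1\<close> is used; smallness comes from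
    the slope \<open>e\<close> in front of the flux.\<close>
  moreover have "flux ?R s \<le> \<gamma> / 2 * M s * 1"
    using flux_bounds(2)[OF R s] mult_left_mono[OF A_bounds(2)[OF R, of s] M] s by linarith
  then have "e * flux ?R s \<le> e * (\<gamma> / 2 * M s * 1)"
    using e by (intro mult_left_mono) auto
  moreover have "0 \<le> (1 + e) * flux x s" using flux_bounds(1)[OF x s] e by simp
  ultimately show "K e x s \<le> \<gamma> * e * M s" unfolding K by (simp add: algebra_simps)
  have "(1 + e) * flux x s \<le> (1 + e) * (\<gamma> / 2 * M s * A x s)"
    using e by (intro mult_left_mono flux_bounds(2) x s) auto
  moreover have "0 \<le> flux e s" "0 \<le> e * flux ?R s"
    using flux_bounds(1) R e s by auto
  moreover have "(1 + e) * (\<gamma> / 2) * M s * A x s = (1 + e) * (\<gamma> / 2 * M s * A x s)" by simp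
  ultimately show "- ((1 + e) * (\<gamma> / 2) * M s * A x s) \<le> K e x s"
    unfolding K by linarith
qed

lemma tent_evolution:
  assumes "0 < e" "e < x" "0 < s" "s \<le> t"
  shows "(LBINT w:{0<..}. tent e x w * \<rho> w t) - (LBINT w:{0<..}. tent e x w * \<rho> w s) =
      integral {s..t} (K e x)"
    and "K e x integrable_on {s..t}"
proof -
  have "continuous_on {e..tent_end e x} (tent e x)"
    unfolding tent_def by (intro continuous_intros)
  moreover have "continuous_on ({e..tent_end e x} \<times> {s..t}) (\<lambda>(w, t). \<rho>\<^sub>t w t)"
    by (rule continuous_on_subset[OF cont]) (use assms in auto)
  ultimately have *:
    "integral {e..tent_end e x} (\<lambda>w. tent e x w * (\<rho> w t - \<rho> w s)) = integral {s..t} (K e x)"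
    "K e x integrable_on {s..t}"
    using integral_time_increment[of s t e "tent_end e x" "tent e x" \<rho>\<^sub>t \<rho>] \<rho>_deriv assms
    unfolding K_def[abs_def] by auto
  show "K e x integrable_on {s..t}" by (rule *)
  show "(LBINT w:{0<..}. tent e x w * \<rho> w t) - (LBINT w:{0<..}. tent e x w * \<rho> w s) =
      integral {s..t} (K e x)"
    using tent_set_integral[OF density[of t] density[of s] assms(1,2)] assms(3,4) *(1) by simp
qed

text \<open>Only the outer kinks can increase the tent integral, and their contribution vanishes
  with \<open>e\<close>. Monotonicity later allows \<open>A x r\<close> to be replaced by its value
  at the start of a time interval.\<close>

lemma A_antimono:
  assumes x: "0 < x" and st: "0 < s" "s \<le> t" "t \<le> T"
  shows "A x t \<le> A x s"
proof (rule le_of_le_add_small[OF x])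
  fix e assume e: "0 < e" "e < x"
  have "integral {s..t} (K e x) \<le> integral {s..t} (\<lambda>r. \<gamma> * e * M r)"
    using st
    by (intro integral_le tent_evolution(2)[OF e] integrable_on_mult_right M_integrable_on
        K_bounds e) auto
  also have "\<dots> = \<gamma> * e * integral {s..t} M" by simp
  finally have "integral {s..t} (K e x) \<le> \<gamma> * e * integral {s..t} M" .
  then show "A x t \<le> A x s + e * (\<gamma> * integral {s..t} M + 2)"
    using truncated_mean_le_tent[OF density[of t] e] tent_le_truncated_mean[OF density[of s] e]
      tent_evolution(1)[OF e st(1,2)] st
    by (simp add: A_def algebra_simps)
qed

text \<open>Freezing \<open>A x r\<close> at the larger \<open>A x s\<close> leaves \<open>M\<close>
  as the only time-dependent factor in the lower bound for \<open>K\<close>, which is then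
  integrated directly.\<close>

lemma A_short_decay:
  assumes x: "0 < x" and st: "0 < s" "s \<le> t" "t \<le> T"
  shows "A x s * (1 - \<gamma> / 2 * integral {s..t} M) \<le> A x t"
proof (rule le_of_le_add_small[OF x])
  fix e assume e: "0 < e" "e < x"
  let ?c = "(1 + e) * (\<gamma> / 2) * A x s"
  have lower: "- ?c * M r \<le> K e x r" if r: "r \<in> {s..t}" for r
  proof -
    have "(1 + e) * (\<gamma> / 2) * M r * A x r \<le> (1 + e) * (\<gamma> / 2) * M r * A x s"
      using r st x e \<gamma>_pos M_nonneg by (intro mult_left_mono A_antimono) auto
    also have "\<dots> = ?c * M r" by simp
    finally show ?thesis using K_bounds(2)[OF e, of r] r st by simp
  qed
  have "- ?c * integral {s..t} M = integral {s..t} (\<lambda>r. - ?c * M r)" by simp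
  also have "\<dots> \<le> integral {s..t} (K e x)"
    using st
    by (intro integral_le tent_evolution(2)[OF e] integrable_on_mult_right M_integrable_on lower)
       auto
  finally have "- ?c * integral {s..t} M \<le> integral {s..t} (K e x)" .
  \<comment> \<open>The factor \<open>1 + e\<close> in \<open>?c\<close> is split, so that its
    \<open>e\<close> part joins the tent error \<open>2 * e\<close>.\<close>
  moreover have eq: "A x s * (1 - \<gamma> / 2 * integral {s..t} M) =
      A x s + - ?c * integral {s..t} M + e * (\<gamma> / 2 * A x s * integral {s..t} M)"
    "e * (\<gamma> / 2 * A x s * integral {s..t} M + 2) =
      e * (\<gamma> / 2 * A x s * integral {s..t} M) + 2 * e"
    by (simp_all add: field_simps)
  ultimately show "A x s * (1 - \<gamma> / 2 * integral {s..t} M) \<le>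
      A x t + e * (\<gamma> / 2 * A x s * integral {s..t} M + 2)"
    using truncated_mean_le_tent[OF density[of s] e] tent_le_truncated_mean[OF density[of t] e]
      tent_evolution(1)[OF e st(1,2)] st eq
    unfolding A_def[symmetric] by linarith
qed

text \<open>Subdivision is applied to \<open>\<gamma> / 2\<close> times the integral of
  \<open>M\<close> from \<open>s\<close>. The exponent is then taken over all of
  \<open>{0..T}\<close>, making the factor independent of \<open>s\<close> for the limit at time
  0.\<close>

lemma A_decay_pos:
  assumes x: "0 < x" and s: "0 < s" "s \<le> T"
  shows "A x s * exp (- (\<gamma> / 2) * integral {0..T} M) \<le> A x T"
proof -
  let ?m = "\<lambda>r. \<gamma> / 2 * integral {s..r} M"
  have split: "integral {s..q} M = integral {s..p} M + integral {p..q} M"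
    if "s \<le> p" "p \<le> q" "q \<le> T" for p q
    using that s by (intro Henstock_Kurzweil_Integration.integral_combine[symmetric] M_integrable_on)
      auto
  have nonneg: "0 \<le> integral {p..q} M" if "0 \<le> p" "q \<le> T" for p q
    using that by (intro integral_nonneg M_integrable_on M_nonneg) auto
  have "A x s * exp (- (?m T - ?m s)) \<le> A x T"
  proof (rule exp_decay_of_short_decay[OF s(2)])
    show "continuous_on {s..T} ?m"
      using s by (intro continuous_intros indefinite_integral_continuous_1 M_integrable_on) auto
    show "mono_on {s..T} ?m"
    proof (rule mono_onI)
      fix p q assume "p \<in> {s..T}" "q \<in> {s..T}" "p \<le> q"
      then have "integral {s..p} M \<le> integral {s..q} M"
        using split[of p q] nonneg[of p q] s by simp
      then show "?m p \<le> ?m q" using \<gamma>_pos by simp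
    qed
    show "0 \<le> A x s" using A_bounds x s by simp
    fix p q assume pq: "s \<le> p" "p \<le> q" "q \<le> T"
    show "A x p * (1 - (?m q - ?m p)) \<le> A x q"
      using A_short_decay[OF x, of p q] pq s split[OF pq] by (simp add: algebra_simps)
  qed
  moreover have "integral {s..T} M \<le> integral {0..T} M"
    using s Henstock_Kurzweil_Integration.integral_combine[of 0 s T M] M_integrable_on[of 0 T]
      nonneg[of 0 s] by simp
  then have "A x s * exp (- (\<gamma> / 2) * integral {0..T} M) \<le> A x s * exp (- (?m T - ?m s))"
    using \<gamma>_pos A_bounds[OF x, of s] s by (intro mult_left_mono) auto
  ultimately show ?thesis by linarith
qed

text \<open>The weight \<open>min w x\<close> is at most \<open>x\<close>, so attainment of the
  initial datum in \<open>L\<^sup>1\<close> suffices.\<close>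

lemma A_tendsto_initial:
  assumes x: "0 < x"
  shows "(A x \<longlongrightarrow> A x 0) (at_right 0)"
proof -
  have "((\<lambda>s. A x s - A x 0) \<longlongrightarrow> 0) (at_right 0)"
  proof (rule Lim_null_comparison)
    show "((\<lambda>s. x * (LBINT w:{0<..}. \<bar>\<rho> w s - \<rho> w 0\<bar>)) \<longlongrightarrow> 0) (at_right 0)"
      by (rule tendsto_mult_right_zero[OF initial])
    show "\<forall>\<^sub>F s in at_right 0. norm (A x s - A x 0) \<le> x * (LBINT w:{0<..}. \<bar>\<rho> w s - \<rho> w 0\<bar>)"
      using eventually_at_right_less[of "0::real"]
    proof eventually_elim
      case (elim s)
      note d = density[of s] density[of 0]
      have i: "set_integrable lborel {0<..} (\<lambda>w. \<rho> w s)" "set_integrable lborel {0<..} (\<lambda>w. \<rho> w 0)"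
        using d elim by (auto simp: normalized_density_def)
      have j: "set_integrable lborel {0<..} (\<lambda>w. min w x * (\<rho> w s - \<rho> w 0))"
        using set_integral_diff(1)[OF min_integrable[OF d(1) x] min_integrable[OF d(2) x]] elim
        by (simp add: algebra_simps)
      have k: "set_integrable lborel {0<..} (\<lambda>w. x * \<bar>\<rho> w s - \<rho> w 0\<bar>)"
        by (intro set_integrable_mult_right set_integrable_abs set_integral_diff i)
      have eq: "A x s - A x 0 = (LBINT w:{0<..}. min w x * (\<rho> w s - \<rho> w 0))"
        using set_integral_diff(2)[OF min_integrable[OF d(1) x] min_integrable[OF d(2) x]] elim
        by (simp add: A_def truncated_mean_def algebra_simps)
      have "norm (A x s - A x 0) \<le>
          (\<integral>w. norm (indicator {0<..} w *\<^sub>R (min w x * (\<rho> w s - \<rho> w 0))) \<partial>lborel)"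
        unfolding eq set_lebesgue_integral_def by (rule integral_norm_bound)
      also have "\<dots> \<le> (LBINT w:{0<..}. x * \<bar>\<rho> w s - \<rho> w 0\<bar>)"
        unfolding set_lebesgue_integral_def
      proof (rule integral_mono')
        show "integrable lborel (\<lambda>w. indicator {0<..} w *\<^sub>R (x * \<bar>\<rho> w s - \<rho> w 0\<bar>))"
          using k by (simp add: set_integrable_def)
      qed (use x in \<open>auto simp: indicator_def abs_mult intro!: mult_right_mono\<close>)
      finally show ?case by simp
    qed
  qed
  then show ?thesis by (simp add: LIM_zero_iff)
qed

lemma A_decay:
  assumes x: "0 < x" and T: "0 < T"
  shows "A x 0 * exp (- (\<gamma> / 2) * integral {0..T} M) \<le> A x T"
proof (rule tendsto_upperbound)
  show "((\<lambda>s. A x s * exp (- (\<gamma> / 2) * integral {0..T} M)) \<longlongrightarrow>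
      A x 0 * exp (- (\<gamma> / 2) * integral {0..T} M)) (at_right 0)"
    by (intro tendsto_intros A_tendsto_initial x)
  show "\<forall>\<^sub>F s in at_right 0. A x s * exp (- (\<gamma> / 2) * integral {0..T} M) \<le> A x T"
    using eventually_at_right_real[OF T] by eventually_elim (use A_decay_pos[OF x] in auto)
qed simp

end

section \<open>The symmetric bilinear form and the Gini coefficient\<close>

lemma min_kernel_integrable:
  assumes p: "normalized_density p" and q: "normalized_density q"
  shows "integrable (lborel \<Otimes>\<^sub>M lborel)
    (\<lambda>(w, x). min w x * ((indicator {0<..} w * p w) * (indicator {0<..} x * q x)))"
proof -
  define P where "P w = indicator {0<..} w * p w" for w
  define Q where "Q w = indicator {0<..} w * q w" for w
  have P: "integrable lborel P" "integrable lborel (\<lambda>w. w * P w)" "\<And>w. 0 \<le> P w"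
    using p by (auto simp: P_def[abs_def] normalized_density_def set_integrable_def
        mult.left_commute indicator_def)
  have Q: "integrable lborel Q" "\<And>w. 0 \<le> Q w"
    using q by (auto simp: Q_def[abs_def] normalized_density_def set_integrable_def indicator_def)
  have [measurable]: "P \<in> borel_measurable borel" "Q \<in> borel_measurable borel"
    using borel_measurable_integrable[OF P(1)] borel_measurable_integrable[OF Q(1)] by simp_all
  \<comment> \<open>The majorant comes from \<open>min w x \<le> w\<close>: it pairs the first
    moment of \<open>p\<close> with the mass of \<open>q\<close>.\<close>
  have "integrable (lborel \<Otimes>\<^sub>M lborel) (\<lambda>(w, x). (w * P w) * Q x)"
  proof (rule lborel_pair.Fubini_integrable)
    have "(\<lambda>w. LBINT x. norm ((w * P w) * Q x)) = (\<lambda>w. \<bar>w * P w\<bar> * (LBINT x. \<bar>Q x\<bar>))"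
      by (simp add: abs_mult)
    then show "integrable lborel (\<lambda>w. LBINT x. norm (case (w, x) of (w, x) \<Rightarrow> (w * P w) * Q x))"
      using P(2) by simp
  qed (use Q(1) in simp_all)
  then have "integrable (lborel \<Otimes>\<^sub>M lborel) (\<lambda>(w, x). min w x * (P w * Q x))"
  proof (rule Bochner_Integration.integrable_bound)
    show "AE z in lborel \<Otimes>\<^sub>M lborel. norm (case z of (w, x) \<Rightarrow> min w x * (P w * Q x)) \<le>
        norm (case z of (w, x) \<Rightarrow> (w * P w) * Q x)"
    proof (intro AE_I2, clarify)
      fix w x :: real
      have "\<bar>min w x\<bar> * (P w * Q x) \<le> \<bar>w\<bar> * (P w * Q x)"
      proof (cases "0 < w \<and> 0 < x")
        case True
        then show ?thesis using P(3) Q(2) by (intro mult_right_mono) auto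
      qed (auto simp: P_def Q_def)
      then show "norm (min w x * (P w * Q x)) \<le> norm ((w * P w) * Q x)"
        using P(3)[of w] Q(2)[of x] by (simp add: abs_mult mult.assoc)
    qed
  qed measurable
  then show ?thesis by (simp add: P_def Q_def)
qed

lemma min_kernel_section:
  "(LBINT x. min w x * ((indicator {0<..} w * p w) * (indicator {0<..} x * q x))) =
    indicator {0<..} w *\<^sub>R (truncated_mean q w * p w)"
proof -
  have "(LBINT x. min w x * ((indicator {0<..} w * p w) * (indicator {0<..} x * q x))) =
      (LBINT x. (indicator {0<..} w * p w) * (indicator {0<..} x *\<^sub>R (min x w * q x)))"
    by (intro Bochner_Integration.integral_cong) (auto simp: min.commute)
  then show ?thesis by (simp add: truncated_mean_def set_lebesgue_integral_def)
qed

text \<open>The integrand is the inner integral of the integrable kernel, so Fubini gives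
  measurability and integrability at once.\<close>

lemma truncated_mean_weight_integrable:
  assumes "normalized_density p" "normalized_density q"
  shows "set_integrable lborel {0<..} (\<lambda>w. truncated_mean q w * p w)"
  using lborel_pair.integrable_fst'[OF min_kernel_integrable[OF assms]]
  by (simp add: min_kernel_section set_integrable_def)

text \<open>Fubini and the symmetry of \<open>min\<close>; this is what lets the decay in one
  argument be used in both.\<close>

lemma truncated_mean_weight_commute:
  assumes p: "normalized_density p" and q: "normalized_density q"
  shows "(LBINT w:{0<..}. truncated_mean q w * p w) = (LBINT w:{0<..}. truncated_mean p w * q w)"
proof -
  have "(LBINT w:{0<..}. truncated_mean q w * p w) =
      (LBINT w. LBINT x. min w x * ((indicator {0<..} w * p w) * (indicator {0<..} x * q x)))"
    by (simp add: min_kernel_section set_lebesgue_integral_def)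
  also have "\<dots> =
      (LBINT x. LBINT w. min w x * ((indicator {0<..} w * p w) * (indicator {0<..} x * q x)))"
    by (rule lborel_pair.Fubini_integral[symmetric, OF min_kernel_integrable[OF p q]])
  also have "\<dots> =
      (LBINT x. LBINT w. min x w * ((indicator {0<..} x * q x) * (indicator {0<..} w * p w)))"
    by (simp add: min.commute mult.commute)
  also have "\<dots> = (LBINT w:{0<..}. truncated_mean p w * q w)"
    by (simp only: min_kernel_section set_lebesgue_integral_def)
  finally show ?thesis .
qed

lemma gini_eq: "gini p = 1 - (LBINT w:{0<..}. truncated_mean p w * p w)"
proof -
  have "(LBINT x:{0<..}. min w x * p w * p x) = truncated_mean p w * p w" for w
  proof -
    have "(LBINT x:{0<..}. min w x * p w * p x) = (LBINT x:{0<..}. (min x w * p x) * p w)"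
      by (simp add: min.commute mult_ac)
    then show ?thesis by (simp add: truncated_mean_def)
  qed
  then show ?thesis by (simp add: gini_def)
qed

lemma (in yard_sale_flow) gini_bound:
  assumes T: "0 < T"
  shows "(1 - gini (\<lambda>w. \<rho> w 0)) * exp (- \<gamma> * integral {0..T} M) \<le> 1 - gini (\<lambda>w. \<rho> w T)"
proof -
  let ?k = "exp (- (\<gamma> / 2) * integral {0..T} M)"
  let ?p = "\<lambda>w. \<rho> w 0" and ?q = "\<lambda>w. \<rho> w T"
  have p: "normalized_density ?p" and q: "normalized_density ?q"
    using density T by auto
  \<comment> \<open>The density \<open>r\<close> stays arbitrary because the estimate is needed
    first with \<open>?p\<close> and then with \<open>?q\<close>.\<close>
  have decay: "?k * (LBINT w:{0<..}. truncated_mean ?p w * r w) \<le>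
      (LBINT w:{0<..}. truncated_mean ?q w * r w)" if r: "normalized_density r" for r
  proof -
    have "(LBINT w:{0<..}. (?k * truncated_mean ?p w) * r w) \<le>
        (LBINT w:{0<..}. truncated_mean ?q w * r w)"
    proof (rule normalized_density_weight_mono[OF r])
      show "set_integrable lborel {0<..} (\<lambda>w. (?k * truncated_mean ?p w) * r w)"
        unfolding mult.assoc
        by (intro set_integrable_mult_right truncated_mean_weight_integrable p r)
      show "?k * truncated_mean ?p w \<le> truncated_mean ?q w" if "0 < w" for w
        using A_decay[OF that T] by (simp add: A_def mult.commute)
    qed (intro truncated_mean_weight_integrable q r)
    then show ?thesis by (simp add: mult.assoc)
  qed
  \<comment> \<open>Each argument of the form contributes half of the rate.\<close>
  have "exp (- \<gamma> * integral {0..T} M) = ?k * ?k"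
    by (simp add: exp_add[symmetric] field_simps)
  then have "(1 - gini ?p) * exp (- \<gamma> * integral {0..T} M) =
      ?k * (?k * (LBINT w:{0<..}. truncated_mean ?p w * ?p w))"
    by (simp add: gini_eq)
  also have "\<dots> \<le> ?k * (LBINT w:{0<..}. truncated_mean ?q w * ?p w)"
    by (intro mult_left_mono decay p) simp
  also have "\<dots> = ?k * (LBINT w:{0<..}. truncated_mean ?p w * ?q w)"
    by (simp add: truncated_mean_weight_commute[OF p q])
  also have "\<dots> \<le> (LBINT w:{0<..}. truncated_mean ?q w * ?q w)"
    by (rule decay[OF q])
  finally show ?thesis by (simp add: gini_eq)
qed

theorem claim4p7:
  fixes \<gamma> t :: real and \<rho> :: "real \<Rightarrow> real \<Rightarrow> real"
    and G :: "real \<Rightarrow> real" and M :: "real \<Rightarrow> ereal"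
  defines "G \<equiv> \<lambda>s. gini (\<lambda>w. \<rho> w s)"
    and "M \<equiv> \<lambda>s. Linfty_norm (\<lambda>w. \<rho> w s)"
  assumes "0 < \<gamma>" and "\<gamma> < 1"
    and "\<And>s. 0 \<le> s \<Longrightarrow> normalized_density (\<lambda>w. \<rho> w s)"
    and "yard_sale_solution \<gamma> \<rho>"
    and "0 < t"
    and "\<And>s. s \<in> {0..t} \<Longrightarrow> M s < \<infinity>"
    and "set_integrable lborel {0..t} (\<lambda>s. real_of_ereal (M s))"
  shows "G t \<le> G 0 * exp (- \<gamma> * (LBINT s:{0..t}. real_of_ereal (M s)))
      + (exp (\<gamma> * (LBINT s:{0..t}. real_of_ereal (M s))) - 1)
        / exp (\<gamma> * (LBINT s:{0..t}. real_of_ereal (M s)))"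
proof -
  obtain \<rho>\<^sub>t f\<^sub>w f\<^sub>w\<^sub>w where
    eqn: "\<forall>w>0. \<forall>t>0.
       ((\<lambda>s. \<rho> w s) has_real_derivative \<rho>\<^sub>t w t) (at t) \<and>
       ((\<lambda>v. diffusion \<gamma> v (\<lambda>x. \<rho> x t) * \<rho> v t) has_real_derivative f\<^sub>w w t) (at w) \<and>
       ((\<lambda>v. f\<^sub>w v t) has_real_derivative f\<^sub>w\<^sub>w w t) (at w) \<and>
       \<rho>\<^sub>t w t = f\<^sub>w\<^sub>w w t"
    and cont: "continuous_on ({0<..} \<times> {0<..}) (\<lambda>(w, t). \<rho>\<^sub>t w t)"
    and initial: "((\<lambda>t. LBINT w:{0<..}. \<bar>\<rho> w t - \<rho> w 0\<bar>) \<longlongrightarrow> 0) (at_right 0)"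
    using \<open>yard_sale_solution \<gamma> \<rho>\<close> unfolding yard_sale_solution_def by blast
  have "yard_sale_flow \<gamma> t \<rho> \<rho>\<^sub>t f\<^sub>w f\<^sub>w\<^sub>w"
    by (rule yard_sale_flow.intro[OF assms(3,5) _ _ _ _ cont initial assms(8,9)[unfolded M_def]])
       (use eqn in blast)+
  then interpret flow: yard_sale_flow \<gamma> t \<rho> \<rho>\<^sub>t f\<^sub>w f\<^sub>w\<^sub>w .
  let ?I = "LBINT s:{0..t}. real_of_ereal (M s)"
  have "?I = integral {0..t} flow.M"
    using set_borel_integral_eq_integral(2)[OF assms(9)]
    unfolding M_def flow.M_def[abs_def] .
  then have "(1 - G 0) * exp (- \<gamma> * ?I) \<le> 1 - G t"
    using flow.gini_bound[OF \<open>0 < t\<close>] by (simp only: G_def)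
  \<comment> \<open>The second summand of the claim is \<open>1 - exp (- \<gamma> * ?I)\<close>, so
    the claim is \<open>gini_bound\<close> rearranged.\<close>
  moreover have "(exp (\<gamma> * ?I) - 1) / exp (\<gamma> * ?I) = 1 - exp (- \<gamma> * ?I)"
    by (simp add: diff_divide_distrib exp_minus inverse_eq_divide)
  ultimately show ?thesis by (simp add: left_diff_distrib)
qed

end
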